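(* An $\aleph$-space $X$ is metrizable if and only if $X$ is a Fréchet–Urysohn space having property $(\alpha_4)$.
   Context: A $k$-network in $X$ is a family $\mathcal N$ of subsets such that whenever $K\subset U$ with $K$ compact and $U$ open, there is a finite $\mathcal F\subset\mathcal N$ with $K\subset\bigcup\mathcal F\subset U$; an $\aleph$-space is a regular space with a $\sigma$-locally finite $k$-network. $X$ has property $(\alpha_4)$ at $x\in X$ if for any family $\{x_{m,n}:(m,n)\in\mathbb N\times\mathbb N\}\subset X$ with $\lim_n x_{m,n}=x$ for every $m$, there exist a sequence $(m_k)_k$ of distinct natural numbers and a sequence $(n_k)_k$ of natural numbers with $\lim_k x_{m_k,n_k}=x$; $X$ has property $(\alpha_4)$ if it has it at every point. *)

theory Defs
  imports "HOL-Analysis.Analysis"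
begin

definition k_network :: "'a topology \<Rightarrow> 'a set set \<Rightarrow> bool" where
  "k_network X \<N> \<longleftrightarrow>
     (\<forall>N\<in>\<N>. N \<subseteq> topspace X) \<and>
     (\<forall>K U. compactin X K \<and> openin X U \<and> K \<subseteq> U \<longrightarrow>
        (\<exists>\<F>. finite \<F> \<and> \<F> \<subseteq> \<N> \<and> K \<subseteq> \<Union>\<F> \<and> \<Union>\<F> \<subseteq> U))"

definition sigma_locally_finite :: "'a topology \<Rightarrow> 'a set set \<Rightarrow> bool" where
  "sigma_locally_finite X \<N> \<longleftrightarrow>
     (\<exists>\<A> :: nat \<Rightarrow> 'a set set. \<N> = (\<Union>n. \<A> n) \<and> (\<forall>n. locally_finite_in X (\<A> n)))"

text \<open>Regular is taken in the usual sense including T1 (T3).\<close>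
definition aleph_space :: "'a topology \<Rightarrow> bool" where
  "aleph_space X \<longleftrightarrow> regular_space X \<and> t1_space X \<and>
     (\<exists>\<N>. k_network X \<N> \<and> sigma_locally_finite X \<N>)"

definition frechet_urysohn :: "'a topology \<Rightarrow> bool" where
  "frechet_urysohn X \<longleftrightarrow>
     (\<forall>A x. A \<subseteq> topspace X \<and> x \<in> X closure_of A \<longrightarrow>
        (\<exists>s :: nat \<Rightarrow> 'a. range s \<subseteq> A \<and> limitin X s x sequentially))"

definition alpha4_at :: "'a topology \<Rightarrow> 'a \<Rightarrow> bool" where
  "alpha4_at X x \<longleftrightarrow>
     (\<forall>xs :: nat \<Rightarrow> nat \<Rightarrow> 'a.
        (\<forall>m n. xs m n \<in> topspace X) \<and> (\<forall>m. limitin X (xs m) x sequentially) \<longrightarrow>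
        (\<exists>mk nk :: nat \<Rightarrow> nat. inj mk \<and> limitin X (\<lambda>k. xs (mk k) (nk k)) x sequentially))"

definition alpha4 :: "'a topology \<Rightarrow> bool" where
  "alpha4 X \<longleftrightarrow> (\<forall>x\<in>topspace X. alpha4_at X x)"

end

theory Submission
  imports Defs
begin

text \<open>
  Metric spaces are Frechet--Urysohn, and they satisfy \<open>(\<alpha>\<^sub>4)\<close>: from the \<open>m\<close>-th sequence
  pick a term within \<open>1 / (m + 1)\<close> of the limit.

  Conversely, write the \<open>\<sigma>\<close>-locally finite \<open>k\<close>-network as an increasing union of locally finite
  families \<open>A k\<close>. For an open \<open>U \<ni> x\<close>, some level \<open>A k\<close> has the property that its members
  inside \<open>U\<close> whose closure contains \<open>x\<close> cover a neighbourhood of \<open>x\<close>: otherwise the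
  Frechet--Urysohn property gives sequences converging to \<open>x\<close> from outside these unions, and
  \<open>(\<alpha>\<^sub>4)\<close> turns them into one convergent sequence meeting infinitely many levels, whereas the
  finitely many network members covering this compact sequence lie in a single level. Hence every
  open cover has a locally finite refinement, each \<open>A k\<close> has a locally finite open expansion
  \<open>S k\<close>, and the sets \<open>int (\<Union>F) \<inter> \<Inter>(S k ` F)\<close> for finite \<open>F \<subseteq> A k\<close> form a
  \<open>\<sigma>\<close>-locally finite base. The Nagata--Smirnov theorem, via a supremum metric built from
  Urysohn functions, finishes the proof.
\<close>

section \<open>Metrizable spaces\<close>

lemma metrizable_imp_frechet_urysohn:
  assumes "metrizable_space X"
  shows "frechet_urysohn X"
proof -
  obtain M d where "Metric_space M d" and X: "X = Metric_space.mtopology M d"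
    using assms unfolding metrizable_space_def by blast
  then interpret Metric_space M d by simp
  show ?thesis
    unfolding frechet_urysohn_def X closure_of_sequentially by blast
qed

lemma metrizable_imp_alpha4:
  assumes "metrizable_space X"
  shows "alpha4 X"
proof -
  obtain M d where "Metric_space M d" and X: "X = Metric_space.mtopology M d"
    using assms unfolding metrizable_space_def by blast
  then interpret Metric_space M d by simp
  show ?thesis
    unfolding alpha4_def alpha4_at_def X
  proof (intro ballI allI impI)
    fix x and xs :: "nat \<Rightarrow> nat \<Rightarrow> 'a"
    assume x: "x \<in> topspace mtopology"
      and xs: "(\<forall>m n. xs m n \<in> topspace mtopology) \<and> (\<forall>m. limitin mtopology (xs m) x sequentially)"
    have "\<exists>n. d (xs m n) x < inverse (Suc m)" for m
    proof -
      have "\<forall>\<^sub>F n in sequentially. d (xs m n) x < inverse (Suc m)"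
        using xs unfolding limitin_metric by (simp add: eventually_conj_iff)
      then show ?thesis
        using eventually_happens' sequentially_bot by blast
    qed
    then obtain nk where nk: "\<And>m. d (xs m (nk m)) x < inverse (Suc m)"
      by metis
    have upper: "\<forall>\<^sub>F k in sequentially. d (xs k (nk k)) x \<le> inverse (Suc k)"
      using nk by (simp add: less_imp_le)
    have "((\<lambda>k. d (xs k (nk k)) x) \<longlongrightarrow> 0) sequentially"
      by (rule tendsto_sandwich[OF _ upper tendsto_const LIMSEQ_inverse_real_of_nat]) simp
    then have "limitin mtopology (\<lambda>k. xs (id k) (nk k)) x sequentially"
      using x xs by (simp add: limitin_metric_dist_null)
    then show "\<exists>mk nk. inj mk \<and> limitin mtopology (\<lambda>k. xs (mk k) (nk k)) x sequentially"
      using inj_on_id by blast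
  qed
qed

section \<open>The Nagata--Smirnov metrization theorem\<close>

text \<open>The value 0 off \<open>S\<close> makes the nonnegativity and symmetry axioms of \<open>Metric_space\<close>
  hold unconditionally; the inserted 0 takes care of \<open>I = {}\<close>.\<close>
definition sup_dist :: "'a set \<Rightarrow> 'i set \<Rightarrow> ('i \<Rightarrow> 'a \<Rightarrow> real) \<Rightarrow> 'a \<Rightarrow> 'a \<Rightarrow> real" where
  "sup_dist S I \<phi> x y =
     (if x \<in> S \<and> y \<in> S then Sup (insert 0 ((\<lambda>i. \<bar>\<phi> i x - \<phi> i y\<bar>) ` I)) else 0)"

lemma bdd_above_sup_dist_set:
  fixes \<phi> :: "'i \<Rightarrow> 'a \<Rightarrow> real"
  assumes "\<And>i x. i \<in> I \<Longrightarrow> x \<in> S \<Longrightarrow> \<phi> i x \<in> {0..1}" and "x \<in> S" "y \<in> S"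
  shows "bdd_above (insert 0 ((\<lambda>i. \<bar>\<phi> i x - \<phi> i y\<bar>) ` I))"
proof (rule bdd_aboveI)
  fix t assume "t \<in> insert 0 ((\<lambda>i. \<bar>\<phi> i x - \<phi> i y\<bar>) ` I)"
  then consider "t = 0" | i where "i \<in> I" "t = \<bar>\<phi> i x - \<phi> i y\<bar>"
    by blast
  then show "t \<le> 1"
  proof cases
    case 2
    then show ?thesis
      using assms(1)[OF 2(1) assms(2)] assms(1)[OF 2(1) assms(3)] by (simp add: abs_le_iff)
  qed simp
qed

lemma sup_dist_ge:
  assumes "\<And>i x. i \<in> I \<Longrightarrow> x \<in> S \<Longrightarrow> \<phi> i x \<in> {0..1}" and "x \<in> S" "y \<in> S" "i \<in> I"
  shows "\<bar>\<phi> i x - \<phi> i y\<bar> \<le> sup_dist S I \<phi> x y"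
  using assms by (auto simp: sup_dist_def intro!: cSup_upper bdd_above_sup_dist_set[OF assms(1)])

lemma sup_dist_le:
  assumes "x \<in> S" "y \<in> S" "0 \<le> c" "\<And>i. i \<in> I \<Longrightarrow> \<bar>\<phi> i x - \<phi> i y\<bar> \<le> c"
  shows "sup_dist S I \<phi> x y \<le> c"
  using assms by (auto simp: sup_dist_def intro!: cSup_least)

lemma Metric_space_sup_dist:
  assumes bound: "\<And>i x. i \<in> I \<Longrightarrow> x \<in> S \<Longrightarrow> \<phi> i x \<in> {0..1}"
    and sep: "\<And>x y. x \<in> S \<Longrightarrow> y \<in> S \<Longrightarrow> x \<noteq> y \<Longrightarrow> \<exists>i\<in>I. \<phi> i x \<noteq> \<phi> i y"
  shows "Metric_space S (sup_dist S I \<phi>)"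
proof
  show nonneg: "0 \<le> sup_dist S I \<phi> x y" for x y
    by (auto simp: sup_dist_def intro!: cSup_upper bdd_above_sup_dist_set[OF bound])
  show "sup_dist S I \<phi> x y = sup_dist S I \<phi> y x" for x y
    by (simp add: sup_dist_def abs_minus_commute conj_commute)
  show "sup_dist S I \<phi> x y = 0 \<longleftrightarrow> x = y" if xy: "x \<in> S" "y \<in> S" for x y
  proof
    assume "x = y"
    then show "sup_dist S I \<phi> x y = 0"
      using sup_dist_le[OF xy, of 0 I \<phi>] nonneg[of x y] by simp
  next
    assume "sup_dist S I \<phi> x y = 0"
    then have "\<phi> i x = \<phi> i y" if "i \<in> I" for i
      using sup_dist_ge[of I S \<phi>, OF bound xy that] by simp
    then show "x = y"
      using sep[OF xy] by blast
  qed
  show "sup_dist S I \<phi> x z \<le> sup_dist S I \<phi> x y + sup_dist S I \<phi> y z"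
    if xyz: "x \<in> S" "y \<in> S" "z \<in> S" for x y z
  proof (rule sup_dist_le[OF xyz(1,3)])
    show "0 \<le> sup_dist S I \<phi> x y + sup_dist S I \<phi> y z"
      using nonneg by (simp add: add_nonneg_nonneg)
    fix i assume "i \<in> I"
    then have "\<bar>\<phi> i x - \<phi> i y\<bar> + \<bar>\<phi> i y - \<phi> i z\<bar> \<le> sup_dist S I \<phi> x y + sup_dist S I \<phi> y z"
      using sup_dist_ge[of I S \<phi>, OF bound xyz(1,2)] sup_dist_ge[of I S \<phi>, OF bound xyz(2,3)] by (simp add: add_mono)
    then show "\<bar>\<phi> i x - \<phi> i z\<bar> \<le> sup_dist S I \<phi> x y + sup_dist S I \<phi> y z"
      by linarith
  qed
qed

locale separating_family =
  fixes X :: "'a topology" and I :: "'i set" and \<phi> :: "'i \<Rightarrow> 'a \<Rightarrow> real"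
  assumes t1: "t1_space X"
    and bound: "\<And>i x. i \<in> I \<Longrightarrow> x \<in> topspace X \<Longrightarrow> \<phi> i x \<in> {0..1}"
    and equicont: "\<And>x e. x \<in> topspace X \<Longrightarrow> e > 0 \<Longrightarrow>
          \<exists>V. openin X V \<and> x \<in> V \<and> (\<forall>z\<in>V. \<forall>i\<in>I. \<bar>\<phi> i x - \<phi> i z\<bar> \<le> e)"
    and sep: "\<And>U x. openin X U \<Longrightarrow> x \<in> U \<Longrightarrow>
          \<exists>i\<in>I. 0 < \<phi> i x \<and> (\<forall>y\<in>topspace X. \<phi> i y \<noteq> 0 \<longrightarrow> y \<in> U)"
begin

abbreviation "d \<equiv> sup_dist (topspace X) I \<phi>"

lemma Metric_space: "Metric_space (topspace X) d"
proof (rule Metric_space_sup_dist[of I "topspace X" \<phi>, OF bound])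
  fix x y assume "x \<in> topspace X" "y \<in> topspace X" "x \<noteq> y"
  then have "openin X (topspace X - {y})" "x \<in> topspace X - {y}"
    using t1 by (auto simp: t1_space_openin_delete_alt)
  then obtain i where "i \<in> I" "0 < \<phi> i x" "\<forall>z\<in>topspace X. \<phi> i z \<noteq> 0 \<longrightarrow> z \<noteq> y"
    using sep by blast
  then show "\<exists>i\<in>I. \<phi> i x \<noteq> \<phi> i y"
    using \<open>y \<in> topspace X\<close> by force
qed

sublocale M: Metric_space "topspace X" d
  by (rule Metric_space)

lemma openin_imp_mopen:
  assumes U: "openin X U"
  shows "openin M.mtopology U"
  unfolding M.openin_mtopology
proof (intro conjI allI impI)
  show "U \<subseteq> topspace X"
    using U by (rule openin_subset)
  fix x assume "x \<in> U"
  then obtain i where i: "i \<in> I" "0 < \<phi> i x" "\<forall>y\<in>topspace X. \<phi> i y \<noteq> 0 \<longrightarrow> y \<in> U"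
    using sep U by blast
  have "z \<in> U" if "z \<in> M.mball x (\<phi> i x)" for z
  proof -
    have z: "x \<in> topspace X" "z \<in> topspace X" "d x z < \<phi> i x"
      using that by auto
    have "\<bar>\<phi> i x - \<phi> i z\<bar> \<le> d x z"
      using sup_dist_ge[of I "topspace X" \<phi>, OF bound z(1,2) i(1)] .
    then have "\<phi> i z \<noteq> 0"
      using z(3) by (metis abs_ge_self diff_zero not_le order.trans)
    then show ?thesis
      using i(3) z(2) by blast
  qed
  then have "M.mball x (\<phi> i x) \<subseteq> U"
    by blast
  with i(2) show "\<exists>r>0. M.mball x r \<subseteq> U"
    by blast
qed

lemma mopen_imp_openin:
  assumes U: "openin M.mtopology U"
  shows "openin X U"
  unfolding openin_subopen[of X U]
proof
  fix x assume "x \<in> U"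
  then obtain r where r: "r > 0" "M.mball x r \<subseteq> U" and x: "x \<in> topspace X"
    using U unfolding M.openin_mtopology by blast
  obtain V where V: "openin X V" "x \<in> V" "\<forall>z\<in>V. \<forall>i\<in>I. \<bar>\<phi> i x - \<phi> i z\<bar> \<le> r / 2"
    using equicont[OF x, of "r / 2"] r(1) by auto
  have "z \<in> M.mball x r" if "z \<in> V" for z
  proof -
    have z: "z \<in> topspace X"
      using openin_subset[OF V(1)] that by blast
    have "d x z \<le> r / 2"
      using V(3) that r(1) by (intro sup_dist_le[OF x z]) auto
    then show ?thesis
      using x z r(1) by simp
  qed
  then show "\<exists>T. openin X T \<and> x \<in> T \<and> T \<subseteq> U"
    using V(1,2) r(2) by blast
qed

lemma metrizable: "metrizable_space X"
proof -
  have "X = M.mtopology"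
    unfolding topology_eq using openin_imp_mopen mopen_imp_openin by blast
  then show ?thesis
    using M.metrizable_space_mtopology by simp
qed

end

lemma locally_finite_levels_nbhd:
  fixes f :: "nat \<Rightarrow> 'b \<Rightarrow> 'a \<Rightarrow> real"
  assumes cont: "\<And>p b. b \<in> J p \<Longrightarrow> continuous_map X euclideanreal (f p b)"
    and lf: "\<And>p y. y \<in> topspace X \<Longrightarrow>
          \<exists>W. openin X W \<and> y \<in> W \<and> finite {b \<in> J p. \<exists>z\<in>W. f p b z \<noteq> 0}"
    and x: "x \<in> topspace X" and "e > 0"
  shows "\<exists>V. openin X V \<and> x \<in> V \<and> (\<forall>z\<in>V. \<forall>p<P. \<forall>b\<in>J p. \<bar>f p b x - f p b z\<bar> < e)"
proof -
  from choice[OF allI[OF lf[OF x]]] obtain W where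
    W: "\<forall>p. openin X (W p) \<and> x \<in> W p \<and> finite {b \<in> J p. \<exists>z\<in>W p. f p b z \<noteq> 0}" ..
  define Fin where "Fin p = {b \<in> J p. \<exists>z\<in>W p. f p b z \<noteq> 0}" for p
  define near where "near p b = {z \<in> topspace X. f p b z \<in> ball (f p b x) e}" for p b
  define \<F> where "\<F> = W ` {..<P} \<union> (\<Union>p<P. near p ` Fin p)"
  show ?thesis
  proof (intro exI[of _ "topspace X \<inter> \<Inter>\<F>"] conjI ballI allI impI)
    show "openin X (topspace X \<inter> \<Inter>\<F>)"
    proof (rule openin_Int_Inter)
      show "finite \<F>"
        using W by (simp add: \<F>_def Fin_def)
      have "openin X (near p b)" if "b \<in> Fin p" for p b
        unfolding near_def using that cont
        by (intro openin_continuous_map_preimage) (auto simp: Fin_def open_openin[symmetric])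
      then show "openin X S" if "S \<in> \<F>" for S
        using that W by (auto simp: \<F>_def)
    qed simp
    show "x \<in> topspace X \<inter> \<Inter>\<F>"
      using x W \<open>e > 0\<close> by (auto simp: \<F>_def near_def)
    fix z p b assume z: "z \<in> topspace X \<inter> \<Inter>\<F>" and "p < P" "b \<in> J p"
    show "\<bar>f p b x - f p b z\<bar> < e"
    proof (cases "b \<in> Fin p")
      case True
      then have "z \<in> near p b"
        using z \<open>p < P\<close> by (auto simp: \<F>_def)
      then show ?thesis
        by (simp add: near_def dist_real_def)
    next
      case False
      have "z \<in> W p"
        using z \<open>p < P\<close> by (auto simp: \<F>_def)
      then have "f p b z = 0" "f p b x = 0"
        using False \<open>b \<in> J p\<close> W by (auto simp: Fin_def)
      then show ?thesis
        using \<open>e > 0\<close> by simp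
    qed
  qed
qed

text \<open>Level \<open>p\<close> is weighted by \<open>1 / (p + 1)\<close>, so that beyond some level all differences are
  uniformly small and only finitely many levels have to be controlled near a point.\<close>
lemma metrizable_space_locally_finite_levels:
  fixes X :: "'a topology" and f :: "nat \<Rightarrow> 'b \<Rightarrow> 'a \<Rightarrow> real"
  assumes t1: "t1_space X"
    and cont: "\<And>p b. b \<in> J p \<Longrightarrow> continuous_map X (top_of_set {0..1}) (f p b)"
    and lf: "\<And>p y. y \<in> topspace X \<Longrightarrow>
          \<exists>W. openin X W \<and> y \<in> W \<and> finite {b \<in> J p. \<exists>z\<in>W. f p b z \<noteq> 0}"
    and sep: "\<And>U x. openin X U \<Longrightarrow> x \<in> U \<Longrightarrow>
          \<exists>p. \<exists>b\<in>J p. f p b x = 1 \<and> (\<forall>y\<in>topspace X. f p b y \<noteq> 0 \<longrightarrow> y \<in> U)"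
  shows "metrizable_space X"
proof -
  have range: "f p b x \<in> {0..1}" if "b \<in> J p" "x \<in> topspace X" for p b x
    using continuous_map_image_subset_topspace[OF cont[OF that(1)]] that(2) by auto
  have cont': "continuous_map X euclideanreal (f p b)" if "b \<in> J p" for p b
    using cont[OF that] continuous_map_in_subtopology by blast
  define \<phi> where "\<phi> i x = f (fst i) (snd i) x / Suc (fst i)" for i x
  interpret separating_family X "Sigma UNIV J" \<phi>
  proof
    fix i x assume "i \<in> Sigma UNIV J" "x \<in> topspace X"
    then show "\<phi> i x \<in> {0..1}"
      using range[of "snd i" "fst i" x] by (auto simp: \<phi>_def divide_le_eq_1)
  next
    fix U x assume "openin X U" "x \<in> U"
    then obtain p b where "b \<in> J p" "f p b x = 1" "\<forall>y\<in>topspace X. f p b y \<noteq> 0 \<longrightarrow> y \<in> U"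
      using sep by blast
    then show "\<exists>i\<in>Sigma UNIV J. 0 < \<phi> i x \<and> (\<forall>y\<in>topspace X. \<phi> i y \<noteq> 0 \<longrightarrow> y \<in> U)"
      by (intro bexI[of _ "(p, b)"]) (auto simp: \<phi>_def)
  next
    fix x and e :: real
    assume x: "x \<in> topspace X" and "e > 0"
    then obtain P where P: "1 / real (Suc P) < e"
      by (metis nat_approx_posE)
    obtain V where V: "openin X V" "x \<in> V" "\<forall>z\<in>V. \<forall>p<P. \<forall>b\<in>J p. \<bar>f p b x - f p b z\<bar> < e"
      using locally_finite_levels_nbhd[where J = J and f = f, OF cont' lf x \<open>e > 0\<close>] by blast
    have "\<bar>f p b x - f p b z\<bar> / Suc p \<le> e" if "z \<in> V" "b \<in> J p" for z p b
    proof (cases "p < P")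
      case False
      have zX: "z \<in> topspace X"
        using that(1) openin_subset[OF V(1)] by blast
      have "\<bar>f p b x - f p b z\<bar> / Suc p \<le> 1 / Suc p"
        using range[OF that(2) x] range[OF that(2) zX] by (intro divide_right_mono) (auto simp: abs_le_iff)
      also have "\<dots> \<le> 1 / Suc P"
        using False by (simp add: frac_le)
      finally show ?thesis
        using P by simp
    next
      case True
      have "\<bar>f p b x - f p b z\<bar> / Suc p \<le> \<bar>f p b x - f p b z\<bar>"
        by (simp add: divide_le_eq mult_le_cancel_left1)
      then show ?thesis
        using V(3) that True by fastforce
    qed
    then have "\<forall>z\<in>V. \<forall>i\<in>Sigma UNIV J. \<bar>\<phi> i x - \<phi> i z\<bar> \<le> e"
      by (auto simp: \<phi>_def diff_divide_distrib[symmetric])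
    with V(1,2) show "\<exists>V. openin X V \<and> x \<in> V \<and> (\<forall>z\<in>V. \<forall>i\<in>Sigma UNIV J. \<bar>\<phi> i x - \<phi> i z\<bar> \<le> e)"
      by blast
  qed (rule t1)
  show ?thesis
    by (rule metrizable)
qed

lemma normal_space_countable_closure_separation:
  assumes "\<And>S T. closedin X S \<Longrightarrow> closedin X T \<Longrightarrow> disjnt S T \<Longrightarrow>
     \<exists>h::nat \<Rightarrow> 'a set. (\<forall>n. openin X (h n)) \<and> (\<forall>n. disjnt T (X closure_of h n)) \<and> S \<subseteq> \<Union>(range h)"
  shows "normal_space X"
  unfolding normal_space_def
proof clarify
  fix S T
  assume clo: "closedin X S" "closedin X T" and "disjnt S T"
  obtain h :: "nat \<Rightarrow> 'a set" where
    opeh: "\<And>n. openin X (h n)" and dish: "\<And>n. disjnt T (X closure_of h n)" and Sh: "S \<subseteq> \<Union>(range h)"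
    using assms[OF clo \<open>disjnt S T\<close>] by blast
  obtain k :: "nat \<Rightarrow> 'a set" where
    opek: "\<And>n. openin X (k n)" and disk: "\<And>n. disjnt S (X closure_of k n)" and Tk: "T \<subseteq> \<Union>(range k)"
    using assms[OF clo(2,1)] \<open>disjnt S T\<close> by (metis disjnt_sym)
  define U where "U \<equiv> \<Union>i. h i - (\<Union>j<i. X closure_of k j)"
  define V where "V \<equiv> \<Union>i. k i - (\<Union>j\<le>i. X closure_of h j)"
  show "\<exists>U V. openin X U \<and> openin X V \<and> S \<subseteq> U \<and> T \<subseteq> V \<and> disjnt U V"
  proof (intro exI conjI)
    show "openin X U" "openin X V"
      unfolding U_def V_def
      by (force intro!: opek opeh closedin_Union closedin_closure_of)+
    show "S \<subseteq> U" "T \<subseteq> V"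
      using Sh Tk dish disk by (fastforce simp: U_def V_def disjnt_iff)+
    have "\<And>x i j. \<lbrakk>x \<in> k i; x \<in> h j; \<forall>j\<le>i. x \<notin> X closure_of h j\<rbrakk>
                 \<Longrightarrow> \<exists>i<j. x \<in> X closure_of k i"
      by (metis in_closure_of linorder_not_less opek openin_subset subsetD)
    then show "disjnt U V"
      by (force simp: U_def V_def disjnt_iff)
  qed
qed

lemma regular_space_closure_of_subset:
  assumes "regular_space X" "openin X W" "x \<in> W"
  obtains U where "openin X U" "x \<in> U" "X closure_of U \<subseteq> W"
proof -
  have "closedin X (topspace X - W)" "x \<in> topspace X - (topspace X - W)"
    using assms(2,3) openin_subset by fastforce+
  then obtain U where "openin X U" "x \<in> U" "disjnt (topspace X - W) (X closure_of U)"
    using assms(1) unfolding regular_space by blast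
  with closure_of_subset_topspace show ?thesis
    using that by (fastforce simp: disjnt_iff)
qed

lemma normal_space_sigma_locally_finite_base:
  assumes reg: "regular_space X" and opn: "\<And>W. W \<in> \<B> \<Longrightarrow> openin X W"
    and lf: "sigma_locally_finite X \<B>"
    and base: "\<And>U x. openin X U \<Longrightarrow> x \<in> U \<Longrightarrow> \<exists>W\<in>\<B>. x \<in> W \<and> W \<subseteq> U"
  shows "normal_space X"
proof (rule normal_space_countable_closure_separation)
  obtain B :: "nat \<Rightarrow> 'a set set" where B: "\<B> = (\<Union>n. B n)" "\<And>n. locally_finite_in X (B n)"
    using lf unfolding sigma_locally_finite_def by blast
  fix S T assume clo: "closedin X S" "closedin X T" and "disjnt S T"
  define h where "h n = \<Union>{W \<in> B n. disjnt T (X closure_of W)}" for n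
  show "\<exists>h::nat \<Rightarrow> 'a set. (\<forall>n. openin X (h n)) \<and> (\<forall>n. disjnt T (X closure_of h n)) \<and> S \<subseteq> \<Union>(range h)"
  proof (intro exI[of _ h] conjI allI)
    fix n
    show "openin X (h n)"
      using opn B(1) by (auto simp: h_def)
    have "X closure_of h n = \<Union>((closure_of) X ` {W \<in> B n. disjnt T (X closure_of W)})"
      unfolding h_def by (rule closure_of_locally_finite_Union[OF locally_finite_in_subset[OF B(2)]]) auto
    then show "disjnt T (X closure_of h n)"
      by (simp add: disjnt_Union2)
  next
    show "S \<subseteq> \<Union>(range h)"
    proof
      fix x assume "x \<in> S"
      then have "x \<in> topspace X - T"
        using clo \<open>disjnt S T\<close> closedin_subset by (auto simp: disjnt_iff)
      then obtain U where U: "openin X U" "x \<in> U" "disjnt T (X closure_of U)"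
        using reg clo(2) unfolding regular_space by blast
      obtain n W where W: "W \<in> B n" "x \<in> W" "W \<subseteq> U"
        using base[OF U(1,2)] B(1) by blast
      have "disjnt T (X closure_of W)"
        by (rule disjnt_subset2[OF U(3) closure_of_mono[OF W(3)]])
      then show "x \<in> \<Union>(range h)"
        unfolding h_def using W(1,2) by blast
    qed
  qed
qed

lemma Urysohn_locally_finite_closures:
  assumes "normal_space X" "openin X W" "locally_finite_in X \<A>"
  obtains f :: "'a \<Rightarrow> real"
  where "continuous_map X (top_of_set {0..1}) f" "f ` (topspace X - W) \<subseteq> {0}"
    "f ` \<Union>{X closure_of A | A. A \<in> \<A> \<and> X closure_of A \<subseteq> W} \<subseteq> {1}"
proof -
  let ?C = "\<Union>{X closure_of A | A. A \<in> \<A> \<and> X closure_of A \<subseteq> W}"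
  have "locally_finite_in X {X closure_of A | A. A \<in> \<A> \<and> X closure_of A \<subseteq> W}"
    by (rule locally_finite_in_subset[OF locally_finite_in_closure[OF assms(3)]]) auto
  then have closed: "closedin X ?C"
    by (rule closedin_locally_finite_Union[rotated]) auto
  have "disjnt (topspace X - W) ?C"
    by (auto simp: disjnt_def)
  then show thesis
    by (rule Urysohn_lemma[OF assms(1) closedin_diff[OF closedin_topspace assms(2)] closed _ zero_le_one])
      (rule that)
qed

lemma regular_space_nested_base:
  assumes reg: "regular_space X" and opn: "\<And>W. W \<in> \<B> \<Longrightarrow> openin X W"
    and base: "\<And>U x. openin X U \<Longrightarrow> x \<in> U \<Longrightarrow> \<exists>W\<in>\<B>. x \<in> W \<and> W \<subseteq> U"
    and U: "openin X U" "x \<in> U"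
  shows "\<exists>W\<in>\<B>. \<exists>A\<in>\<B>. x \<in> X closure_of A \<and> X closure_of A \<subseteq> W \<and> W \<subseteq> U"
proof -
  obtain W where W: "W \<in> \<B>" "x \<in> W" "W \<subseteq> U"
    using base[OF U] by blast
  obtain U' where U': "openin X U'" "x \<in> U'" "X closure_of U' \<subseteq> W"
    using regular_space_closure_of_subset[OF reg opn[OF W(1)] W(2)] by blast
  obtain A where A: "A \<in> \<B>" "x \<in> A" "A \<subseteq> U'"
    using base[OF U'(1,2)] by blast
  have "x \<in> X closure_of A"
    using A(2) closure_of_subset[OF openin_subset[OF opn[OF A(1)]]] by blast
  moreover have "X closure_of A \<subseteq> W"
    using closure_of_mono[OF A(3)] U'(3) by blast
  ultimately show ?thesis
    using W A(1) by blast
qed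

theorem Nagata_Smirnov_metrizable:
  fixes X :: "'a topology"
  assumes reg: "regular_space X" and t1: "t1_space X"
    and opn: "\<And>W. W \<in> \<B> \<Longrightarrow> openin X W"
    and lf: "sigma_locally_finite X \<B>"
    and base: "\<And>U x. openin X U \<Longrightarrow> x \<in> U \<Longrightarrow> \<exists>W\<in>\<B>. x \<in> W \<and> W \<subseteq> U"
  shows "metrizable_space X"
proof -
  obtain B :: "nat \<Rightarrow> 'a set set" where B: "\<B> = (\<Union>n. B n)" "\<And>n. locally_finite_in X (B n)"
    using lf unfolding sigma_locally_finite_def by blast
  have opnB: "openin X W" if "W \<in> B n" for n W
    using opn B(1) that by blast
  have normal: "normal_space X"
    by (rule normal_space_sigma_locally_finite_base[OF reg opn lf base])
  define J where "J p = B (fst (prod_decode p))" for p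
  define Z where "Z p W = \<Union>{X closure_of A | A. A \<in> B (snd (prod_decode p)) \<and> X closure_of A \<subseteq> W}" for p W
  text \<open>Level \<open>p = (k, j)\<close> pairs each \<open>W \<in> B k\<close> with an Urysohn function that is 1 on the
    closures of the members of \<open>B j\<close> whose closure lies in \<open>W\<close>.\<close>
  define urysohn where "urysohn p W (g :: 'a \<Rightarrow> real) \<longleftrightarrow> continuous_map X (top_of_set {0..1}) g \<and>
      g ` (topspace X - W) \<subseteq> {0} \<and> g ` Z p W \<subseteq> {1}" for p W g
  define f where "f p W = (SOME g. urysohn p W g)" for p W
  have f: "urysohn p W (f p W)" if "W \<in> J p" for p W
  proof -
    have "W \<in> B (fst (prod_decode p))"
      using that by (simp add: J_def)
    then obtain g :: "'a \<Rightarrow> real" where "continuous_map X (top_of_set {0..1}) g"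
      "g ` (topspace X - W) \<subseteq> {0}" "g ` Z p W \<subseteq> {1}"
      unfolding Z_def by (rule Urysohn_locally_finite_closures[OF normal opnB B(2)])
    then have "urysohn p W g"
      by (simp add: urysohn_def)
    then show ?thesis
      unfolding f_def by (rule someI[of "urysohn p W"])
  qed
  have support: "y \<in> W" if "W \<in> J p" "y \<in> topspace X" "f p W y \<noteq> 0" for p W y
    using f[OF that(1)] that(2,3) unfolding urysohn_def by blast
  show ?thesis
  proof (rule metrizable_space_locally_finite_levels[OF t1])
    show "continuous_map X (top_of_set {0..1}) (f p W)" if "W \<in> J p" for p W
      using f[OF that] unfolding urysohn_def by blast
  next
    fix p y assume "y \<in> topspace X"
    then obtain V where V: "openin X V" "y \<in> V" "finite {W \<in> J p. W \<inter> V \<noteq> {}}"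
      using B(2) unfolding J_def locally_finite_in_def by blast
    have "{W \<in> J p. \<exists>z\<in>V. f p W z \<noteq> 0} \<subseteq> {W \<in> J p. W \<inter> V \<noteq> {}}"
      using support openin_subset[OF V(1)] by blast
    then show "\<exists>V. openin X V \<and> y \<in> V \<and> finite {W \<in> J p. \<exists>z\<in>V. f p W z \<noteq> 0}"
      using V finite_subset by blast
  next
    fix U x assume "openin X U" "x \<in> U"
    then obtain W A where W: "W \<in> \<B>" "W \<subseteq> U"
      and A: "A \<in> \<B>" "x \<in> X closure_of A" "X closure_of A \<subseteq> W"
      using regular_space_nested_base[OF reg opn base] by blast
    obtain k j where "W \<in> B k" "A \<in> B j"
      using W(1) A(1) B(1) by blast
    define p where "p = prod_encode (k, j)"
    have WJ: "W \<in> J p"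
      using \<open>W \<in> B k\<close> by (simp add: J_def p_def)
    have "x \<in> Z p W"
      using A \<open>A \<in> B j\<close> by (auto simp: Z_def p_def)
    then have "f p W x = 1"
      using f[OF WJ] unfolding urysohn_def by blast
    moreover have "\<forall>y\<in>topspace X. f p W y \<noteq> 0 \<longrightarrow> y \<in> U"
      using support[OF WJ] W(2) by blast
    ultimately show "\<exists>p. \<exists>W\<in>J p. f p W x = 1 \<and> (\<forall>y\<in>topspace X. f p W y \<noteq> 0 \<longrightarrow> y \<in> U)"
      using WJ by blast
  qed
qed

section \<open>Locally finite families\<close>

lemma locally_finite_in_Un:
  assumes "locally_finite_in X \<A>" "locally_finite_in X \<B>"
  shows "locally_finite_in X (\<A> \<union> \<B>)"
  unfolding locally_finite_in_def
proof (intro conjI ballI)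
  show "\<Union>(\<A> \<union> \<B>) \<subseteq> topspace X"
    using assms by (auto simp: locally_finite_in_def)
  fix x assume "x \<in> topspace X"
  then obtain V W where V: "openin X V" "x \<in> V" "finite {U \<in> \<A>. U \<inter> V \<noteq> {}}"
    and W: "openin X W" "x \<in> W" "finite {U \<in> \<B>. U \<inter> W \<noteq> {}}"
    using assms unfolding locally_finite_in_def by meson
  have "{U \<in> \<A> \<union> \<B>. U \<inter> (V \<inter> W) \<noteq> {}} \<subseteq> {U \<in> \<A>. U \<inter> V \<noteq> {}} \<union> {U \<in> \<B>. U \<inter> W \<noteq> {}}"
    by blast
  then have "finite {U \<in> \<A> \<union> \<B>. U \<inter> (V \<inter> W) \<noteq> {}}"
    using V(3) W(3) by (meson finite_UnI finite_subset)
  with V W show "\<exists>V. openin X V \<and> x \<in> V \<and> finite {U \<in> \<A> \<union> \<B>. U \<inter> V \<noteq> {}}"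
    by blast
qed

lemma locally_finite_in_UN_atMost:
  fixes A :: "nat \<Rightarrow> 'a set set"
  assumes "\<And>i. locally_finite_in X (A i)"
  shows "locally_finite_in X (\<Union>i\<le>k. A i)"
proof (induction k)
  case (Suc k)
  then show ?case
    using locally_finite_in_Un[OF Suc assms] by (simp add: atMost_Suc Un_commute)
qed (simp add: assms)

lemma sigma_locally_finite_incseq:
  assumes "sigma_locally_finite X \<N>"
  obtains A :: "nat \<Rightarrow> 'a set set"
  where "\<N> = \<Union>(range A)" "incseq A" "\<And>k. locally_finite_in X (A k)"
proof -
  obtain A0 :: "nat \<Rightarrow> 'a set set" where A0: "\<N> = (\<Union>n. A0 n)" "\<And>n. locally_finite_in X (A0 n)"
    using assms unfolding sigma_locally_finite_def by blast
  show thesis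
  proof (rule that[of "\<lambda>k. \<Union>i\<le>k. A0 i"])
    show "\<N> = \<Union>(range (\<lambda>k. \<Union>i\<le>k. A0 i))"
      unfolding A0(1) by auto
    show "incseq (\<lambda>k. \<Union>i\<le>k. A0 i)"
      unfolding incseq_def by (meson UN_mono atMost_subset_iff order_refl)
  qed (rule locally_finite_in_UN_atMost[OF A0(2)])
qed

lemma finite_subset_incseq:
  fixes A :: "nat \<Rightarrow> 'b set"
  assumes "finite G" "G \<subseteq> \<Union>(range A)" "incseq A"
  shows "\<exists>m. G \<subseteq> A m"
  using assms(1,2)
proof (induction G rule: finite_induct)
  case (insert M G)
  then obtain m i where "G \<subseteq> A m" "M \<in> A i"
    by blast
  then have "insert M G \<subseteq> A (max i m)"
    using incseqD[OF assms(3), of i "max i m"] incseqD[OF assms(3), of m "max i m"] by auto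
  then show ?case
    by blast
qed simp

lemma locally_finite_in_finite_closure_of:
  assumes "locally_finite_in X \<A>" "x \<in> topspace X"
  shows "finite {M \<in> \<A>. x \<in> X closure_of M}"
proof -
  obtain V where V: "openin X V" "x \<in> V" "finite {M \<in> \<A>. M \<inter> V \<noteq> {}}"
    using assms unfolding locally_finite_in_def by blast
  have "{M \<in> \<A>. x \<in> X closure_of M} \<subseteq> {M \<in> \<A>. M \<inter> V \<noteq> {}}"
    using V(1,2) by (auto simp: in_closure_of)
  then show ?thesis
    using V(3) finite_subset by blast
qed

lemma locally_finite_in_finite_Inter_expansion:
  assumes lf: "\<And>y. y \<in> topspace X \<Longrightarrow> \<exists>V. openin X V \<and> y \<in> V \<and> finite {M \<in> \<C>. S M \<inter> V \<noteq> {}}"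
  shows "locally_finite_in X {\<Inter>(insert (X interior_of \<Union>\<F>) (S ` \<F>)) | \<F>. finite \<F> \<and> \<F> \<subseteq> \<C>}"
  unfolding locally_finite_in_def
proof (intro conjI ballI)
  show "\<Union>{\<Inter>(insert (X interior_of \<Union>\<F>) (S ` \<F>)) | \<F>. finite \<F> \<and> \<F> \<subseteq> \<C>} \<subseteq> topspace X"
  proof (rule Union_least)
    fix W assume "W \<in> {\<Inter>(insert (X interior_of \<Union>\<F>) (S ` \<F>)) | \<F>. finite \<F> \<and> \<F> \<subseteq> \<C>}"
    then obtain \<F> where "W = \<Inter>(insert (X interior_of \<Union>\<F>) (S ` \<F>))"
      by blast
    then have "W \<subseteq> X interior_of \<Union>\<F>"
      by blast
    then show "W \<subseteq> topspace X"
      using interior_of_subset_topspace by (rule order.trans)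
  qed
  fix y assume "y \<in> topspace X"
  then obtain V where V: "openin X V" "y \<in> V" "finite {M \<in> \<C>. S M \<inter> V \<noteq> {}}"
    using lf by blast
  have "{W \<in> {\<Inter>(insert (X interior_of \<Union>\<F>) (S ` \<F>)) | \<F>. finite \<F> \<and> \<F> \<subseteq> \<C>}. W \<inter> V \<noteq> {}}
      \<subseteq> (\<lambda>\<F>. \<Inter>(insert (X interior_of \<Union>\<F>) (S ` \<F>))) ` Pow {M \<in> \<C>. S M \<inter> V \<noteq> {}}"
  proof
    fix W assume "W \<in> {W \<in> {\<Inter>(insert (X interior_of \<Union>\<F>) (S ` \<F>)) | \<F>. finite \<F> \<and> \<F> \<subseteq> \<C>}. W \<inter> V \<noteq> {}}"
    then obtain \<F> z where W: "W = \<Inter>(insert (X interior_of \<Union>\<F>) (S ` \<F>))" "\<F> \<subseteq> \<C>" "z \<in> W" "z \<in> V"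
      by blast
    then have "\<F> \<subseteq> {M \<in> \<C>. S M \<inter> V \<noteq> {}}"
      by blast
    then show "W \<in> (\<lambda>\<F>. \<Inter>(insert (X interior_of \<Union>\<F>) (S ` \<F>))) ` Pow {M \<in> \<C>. S M \<inter> V \<noteq> {}}"
      using W(1) by blast
  qed
  then have "finite {W \<in> {\<Inter>(insert (X interior_of \<Union>\<F>) (S ` \<F>)) | \<F>. finite \<F> \<and> \<F> \<subseteq> \<C>}. W \<inter> V \<noteq> {}}"
    by (rule finite_subset) (use V(3) in simp)
  with V(1,2) show "\<exists>V. openin X V \<and> y \<in> V \<and>
      finite {W \<in> {\<Inter>(insert (X interior_of \<Union>\<F>) (S ` \<F>)) | \<F>. finite \<F> \<and> \<F> \<subseteq> \<C>}. W \<inter> V \<noteq> {}}"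
    by blast
qed

text \<open>Paracompactness without requiring the refinement to be open; by a theorem of Michael
  the two notions agree for regular spaces.\<close>
definition locally_finite_refinable :: "'a topology \<Rightarrow> bool" where
  "locally_finite_refinable X \<longleftrightarrow>
     (\<forall>\<U>. (\<forall>U\<in>\<U>. openin X U) \<and> topspace X \<subseteq> \<Union>\<U> \<longrightarrow>
        (\<exists>\<Q>. locally_finite_in X \<Q> \<and> \<Union>\<Q> = topspace X \<and> (\<forall>Q\<in>\<Q>. \<exists>U\<in>\<U>. Q \<subseteq> U)))"

lemma locally_finite_refinableE:
  assumes "locally_finite_refinable X" "\<And>U. U \<in> \<U> \<Longrightarrow> openin X U" "topspace X \<subseteq> \<Union>\<U>"
  obtains \<Q> where "locally_finite_in X \<Q>" "\<Union>\<Q> = topspace X" "\<And>Q. Q \<in> \<Q> \<Longrightarrow> \<exists>U\<in>\<U>. Q \<subseteq> U"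
  using assms unfolding locally_finite_refinable_def by meson

definition layered_refinement :: "'a topology \<Rightarrow> (nat \<Rightarrow> 'a set set) \<Rightarrow> 'a set set" where
  "layered_refinement X A = (\<Union>k. (\<lambda>M. M - X interior_of (\<Union>i<k. \<Union>(A i))) ` A k)"

lemma Union_layered_refinement:
  assumes "\<And>k. \<Union>(A k) \<subseteq> topspace X" "\<And>x. x \<in> topspace X \<Longrightarrow> \<exists>k. x \<in> \<Union>(A k)"
  shows "\<Union>(layered_refinement X A) = topspace X"
proof
  show "\<Union>(layered_refinement X A) \<subseteq> topspace X"
    using assms(1) by (auto simp: layered_refinement_def)
  show "topspace X \<subseteq> \<Union>(layered_refinement X A)"
  proof
    fix x assume "x \<in> topspace X"
    define k where "k = (LEAST k. x \<in> \<Union>(A k))"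
    have "x \<in> \<Union>(A k)"
      unfolding k_def using assms(2)[OF \<open>x \<in> topspace X\<close>] by (rule LeastI_ex)
    then obtain M where "M \<in> A k" "x \<in> M"
      by blast
    moreover have "x \<notin> (\<Union>i<k. \<Union>(A i))"
      using not_less_Least[of _ "\<lambda>k. x \<in> \<Union>(A k)"] unfolding k_def by blast
    then have "x \<notin> X interior_of (\<Union>i<k. \<Union>(A i))"
      using interior_of_subset[of X "\<Union>i<k. \<Union>(A i)"] by blast
    ultimately show "x \<in> \<Union>(layered_refinement X A)"
      unfolding layered_refinement_def by blast
  qed
qed

lemma locally_finite_layered_refinement:
  assumes "incseq A" and lf: "\<And>k. locally_finite_in X (A k)"
    and cover: "\<And>x. x \<in> topspace X \<Longrightarrow> \<exists>k. x \<in> X interior_of \<Union>(A k)"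
  shows "locally_finite_in X (layered_refinement X A)"
  unfolding locally_finite_in_def
proof (intro conjI ballI)
  show "\<Union>(layered_refinement X A) \<subseteq> topspace X"
    using lf by (force simp: layered_refinement_def locally_finite_in_def)
  fix y assume "y \<in> topspace X"
  then obtain j where j: "y \<in> X interior_of \<Union>(A j)"
    using cover by blast
  obtain V where V: "openin X V" "y \<in> V" "finite {M \<in> A j. M \<inter> V \<noteq> {}}"
    using lf[of j] \<open>y \<in> topspace X\<close> unfolding locally_finite_in_def by blast
  define V' where "V' = V \<inter> X interior_of \<Union>(A j)"
  text \<open>Layers beyond \<open>j\<close> have removed the interior of \<open>\<Union>(A j)\<close>, so only layers up to \<open>j\<close>
    can meet \<open>V'\<close>, and their members lie in \<open>A j\<close>.\<close>
  have "{Q \<in> layered_refinement X A. Q \<inter> V' \<noteq> {}} \<subseteq>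
      (\<Union>k\<le>j. (\<lambda>M. M - X interior_of (\<Union>i<k. \<Union>(A i))) ` {M \<in> A j. M \<inter> V \<noteq> {}})"
  proof clarify
    fix Q assume Q: "Q \<in> layered_refinement X A" "Q \<inter> V' \<noteq> {}"
    then obtain k M where kM: "M \<in> A k" "Q = M - X interior_of (\<Union>i<k. \<Union>(A i))"
      unfolding layered_refinement_def by blast
    have "k \<le> j"
    proof (rule ccontr)
      assume "\<not> k \<le> j"
      then have "X interior_of \<Union>(A j) \<subseteq> X interior_of (\<Union>i<k. \<Union>(A i))"
        by (intro interior_of_mono UN_upper) simp
      then show False
        using Q(2) kM(2) by (auto simp: V'_def)
    qed
    moreover have "M \<in> A j" "M \<inter> V \<noteq> {}"
      using kM incseqD[OF \<open>incseq A\<close> \<open>k \<le> j\<close>] Q(2) by (auto simp: V'_def)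
    ultimately show "Q \<in> (\<Union>k\<le>j. (\<lambda>M. M - X interior_of (\<Union>i<k. \<Union>(A i))) ` {M \<in> A j. M \<inter> V \<noteq> {}})"
      using kM(2) by blast
  qed
  then have "finite {Q \<in> layered_refinement X A. Q \<inter> V' \<noteq> {}}"
    by (rule finite_subset) (use V(3) in blast)
  moreover have "openin X V'" "y \<in> V'"
    using V(1,2) j by (auto simp: V'_def)
  ultimately show "\<exists>V. openin X V \<and> y \<in> V \<and> finite {U \<in> layered_refinement X A. U \<inter> V \<noteq> {}}"
    by blast
qed

lemma regular_space_locally_finite_closures_nbhd:
  assumes reg: "regular_space X" and lf: "locally_finite_in X \<C>" and y: "y \<in> topspace X"
  shows "\<exists>W. openin X W \<and> y \<in> W \<and> finite {M \<in> \<C>. X closure_of W \<inter> X closure_of M \<noteq> {}}"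
proof -
  obtain O' where O': "openin X O'" "y \<in> O'" "finite {M \<in> \<C>. M \<inter> O' \<noteq> {}}"
    using lf y unfolding locally_finite_in_def by blast
  obtain W where W: "openin X W" "y \<in> W" "X closure_of W \<subseteq> O'"
    using regular_space_closure_of_subset[OF reg O'(1,2)] by blast
  have "M \<inter> O' \<noteq> {}" if "z \<in> X closure_of W" "z \<in> X closure_of M" for M z
  proof -
    have "z \<in> O'"
      using W(3) that(1) by blast
    then show ?thesis
      using O'(1) that(2) unfolding in_closure_of by blast
  qed
  then have "{M \<in> \<C>. X closure_of W \<inter> X closure_of M \<noteq> {}} \<subseteq> {M \<in> \<C>. M \<inter> O' \<noteq> {}}"
    by blast
  then have "finite {M \<in> \<C>. X closure_of W \<inter> X closure_of M \<noteq> {}}"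
    using O'(3) finite_subset by blast
  with W(1,2) show ?thesis
    by blast
qed

lemma locally_finite_open_expansion_of_cover:
  assumes lfQ: "locally_finite_in X \<Q>" and cover: "\<Union>\<Q> = topspace X"
    and fin: "\<And>Q. Q \<in> \<Q> \<Longrightarrow> finite {M \<in> \<C>. X closure_of Q \<inter> X closure_of M \<noteq> {}}"
  shows "\<exists>S. (\<forall>M. openin X (S M)) \<and> (\<forall>M. X closure_of M \<subseteq> S M) \<and>
           (\<forall>y\<in>topspace X. \<exists>V. openin X V \<and> y \<in> V \<and> finite {M \<in> \<C>. S M \<inter> V \<noteq> {}})"
proof -
  define S where "S M = topspace X - \<Union>{X closure_of Q | Q. Q \<in> \<Q> \<and> X closure_of Q \<inter> X closure_of M = {}}" for M
  show ?thesis
  proof (intro exI[of _ S] conjI allI ballI)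
    fix M
    have "locally_finite_in X {X closure_of Q | Q. Q \<in> \<Q> \<and> X closure_of Q \<inter> X closure_of M = {}}"
      by (rule locally_finite_in_subset[OF locally_finite_in_closure[OF lfQ]]) auto
    then have "closedin X (\<Union>{X closure_of Q | Q. Q \<in> \<Q> \<and> X closure_of Q \<inter> X closure_of M = {}})"
      by (rule closedin_locally_finite_Union[rotated]) auto
    then show "openin X (S M)"
      unfolding S_def by blast
    show "X closure_of M \<subseteq> S M"
      using closure_of_subset_topspace by (fastforce simp: S_def)
  next
    fix y assume "y \<in> topspace X"
    then obtain V where V: "openin X V" "y \<in> V" "finite {Q \<in> \<Q>. Q \<inter> V \<noteq> {}}"
      using lfQ unfolding locally_finite_in_def by blast
    text \<open>A point of \<open>S M \<inter> V\<close> lies in some \<open>Q \<in> \<Q>\<close> meeting \<open>V\<close>, and then \<open>cl Q\<close> meets \<open>cl M\<close>.\<close>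
    have "{M \<in> \<C>. S M \<inter> V \<noteq> {}} \<subseteq>
        (\<Union>Q\<in>{Q \<in> \<Q>. Q \<inter> V \<noteq> {}}. {M \<in> \<C>. X closure_of Q \<inter> X closure_of M \<noteq> {}})"
    proof
      fix M assume "M \<in> {M \<in> \<C>. S M \<inter> V \<noteq> {}}"
      then obtain z where M: "M \<in> \<C>" "z \<in> S M" "z \<in> V"
        by blast
      then have "z \<in> topspace X"
        by (simp add: S_def)
      then obtain Q where Q: "Q \<in> \<Q>" "z \<in> Q"
        using cover by blast
      have "Q \<subseteq> topspace X"
        using Q(1) cover by blast
      then have "z \<in> X closure_of Q"
        using closure_of_subset Q(2) by blast
      then have "X closure_of Q \<inter> X closure_of M \<noteq> {}"
        using M(2) Q(1) by (auto simp: S_def)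
      then show "M \<in> (\<Union>Q\<in>{Q \<in> \<Q>. Q \<inter> V \<noteq> {}}. {M \<in> \<C>. X closure_of Q \<inter> X closure_of M \<noteq> {}})"
        using M Q by blast
    qed
    moreover have "finite (\<Union>Q\<in>{Q \<in> \<Q>. Q \<inter> V \<noteq> {}}. {M \<in> \<C>. X closure_of Q \<inter> X closure_of M \<noteq> {}})"
      using V(3) fin by blast
    ultimately show "\<exists>V. openin X V \<and> y \<in> V \<and> finite {M \<in> \<C>. S M \<inter> V \<noteq> {}}"
      using V(1,2) finite_subset by blast
  qed
qed

lemma locally_finite_open_expansion:
  assumes reg: "regular_space X" and "locally_finite_refinable X" and lf: "locally_finite_in X \<C>"
  shows "\<exists>S. (\<forall>M. openin X (S M)) \<and> (\<forall>M. X closure_of M \<subseteq> S M) \<and>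
           (\<forall>y\<in>topspace X. \<exists>V. openin X V \<and> y \<in> V \<and> finite {M \<in> \<C>. S M \<inter> V \<noteq> {}})"
proof -
  define \<U> where "\<U> = {W. openin X W \<and> finite {M \<in> \<C>. X closure_of W \<inter> X closure_of M \<noteq> {}}}"
  have cover: "topspace X \<subseteq> \<Union>\<U>"
    using regular_space_locally_finite_closures_nbhd[OF reg lf] unfolding \<U>_def by blast
  obtain \<Q> where \<Q>: "locally_finite_in X \<Q>" "\<Union>\<Q> = topspace X" "\<And>Q. Q \<in> \<Q> \<Longrightarrow> \<exists>U\<in>\<U>. Q \<subseteq> U"
    by (rule locally_finite_refinableE[OF \<open>locally_finite_refinable X\<close> _ cover]) (auto simp: \<U>_def)
  have "finite {M \<in> \<C>. X closure_of Q \<inter> X closure_of M \<noteq> {}}" if Q: "Q \<in> \<Q>" for Q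
  proof -
    obtain W where "W \<in> \<U>" "Q \<subseteq> W"
      using \<Q>(3)[OF Q] by blast
    then show ?thesis
      unfolding \<U>_def using closure_of_mono[OF \<open>Q \<subseteq> W\<close>] by (auto elim!: finite_subset[rotated])
  qed
  then show ?thesis
    by (rule locally_finite_open_expansion_of_cover[OF \<Q>(1,2)])
qed

section \<open>Frechet--Urysohn spaces with \<open>(\<alpha>\<^sub>4)\<close>\<close>

lemma inj_eventually_ge:
  fixes f :: "nat \<Rightarrow> nat"
  assumes "inj f"
  shows "\<forall>\<^sub>F j in sequentially. m \<le> f j"
proof -
  have "finite (f -` {..<m})"
    using assms by (simp add: finite_vimageI)
  then show ?thesis
    by (simp add: cofinite_eq_sequentially[symmetric] eventually_cofinite not_le vimage_def)
qed

lemma k_network_subset_topspace: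
  "k_network X \<N> \<Longrightarrow> N \<in> \<N> \<Longrightarrow> N \<subseteq> topspace X"
  unfolding k_network_def by blast

lemma k_network_finite_cover:
  assumes "k_network X \<N>" "compactin X K" "openin X U" "K \<subseteq> U"
  obtains \<F> where "finite \<F>" "\<F> \<subseteq> \<N>" "K \<subseteq> \<Union>\<F>" "\<Union>\<F> \<subseteq> U"
  using assms unfolding k_network_def by meson

lemma k_network_convergent_sequence:
  assumes knet: "k_network X \<N>" and lim: "limitin X y x sequentially"
    and U: "openin X U" "x \<in> U"
  obtains \<G> where "finite \<G>" "\<G> \<subseteq> \<N>" "\<Union>\<G> \<subseteq> U"
    "\<forall>\<^sub>F j in sequentially. \<exists>M\<in>\<G>. y j \<in> M \<and> x \<in> X closure_of M"
proof -
  obtain N where N: "\<And>j. j \<ge> N \<Longrightarrow> y j \<in> U"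
    using lim U unfolding limitin_def eventually_sequentially by blast
  define z where "z j = y (j + N)" for j
  have "limitin X z x sequentially"
    unfolding z_def by (rule limitin_sequentially_offset[OF lim])
  moreover have zU: "range z \<subseteq> U"
    using N by (auto simp: z_def)
  ultimately have "compactin X (insert x (range z))"
    using openin_subset[OF U(1)] by (intro compactin_sequence_with_limit) auto
  moreover have "insert x (range z) \<subseteq> U"
    using zU U(2) by blast
  ultimately obtain \<G> where \<G>: "finite \<G>" "\<G> \<subseteq> \<N>" "insert x (range z) \<subseteq> \<Union>\<G>" "\<Union>\<G> \<subseteq> U"
    using k_network_finite_cover[OF knet _ U(1)] by blast
  have "\<forall>\<^sub>F j in sequentially. y j \<notin> M" if "M \<in> \<G>" "x \<notin> X closure_of M" for M
  proof -
    have "openin X (topspace X - X closure_of M)" "x \<in> topspace X - X closure_of M"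
      using that U openin_subset by auto
    then have "\<forall>\<^sub>F j in sequentially. y j \<in> topspace X - X closure_of M"
      using lim unfolding limitin_def by blast
    moreover have "M \<in> \<N>"
      using that(1) \<G>(2) by blast
    note closure_of_subset[OF k_network_subset_topspace[OF knet this]]
    ultimately show ?thesis
      by (auto elim!: eventually_mono)
  qed
  then have "\<forall>\<^sub>F j in sequentially. \<forall>M\<in>{M \<in> \<G>. x \<notin> X closure_of M}. y j \<notin> M"
    using \<G>(1) by (intro eventually_ball_finite) auto
  moreover have "y j \<in> \<Union>\<G>" if "j \<ge> N" for j
  proof -
    have "y j = z (j - N)"
      using that by (simp add: z_def)
    then show ?thesis
      using \<G>(3) by blast
  qed
  then have "\<forall>\<^sub>F j in sequentially. y j \<in> \<Union>\<G>"
    unfolding eventually_sequentially by blast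
  ultimately have "\<forall>\<^sub>F j in sequentially. \<exists>M\<in>\<G>. y j \<in> M \<and> x \<in> X closure_of M"
    by eventually_elim blast
  then show thesis
    by (rule that[OF \<G>(1,2,4)])
qed

lemma frechet_urysohn_alpha4_level_nbhd:
  fixes A :: "nat \<Rightarrow> 'a set set"
  assumes knet: "k_network X (\<Union>(range A))" and "incseq A"
    and fu: "frechet_urysohn X" and a4: "alpha4 X"
    and U: "openin X U" "x \<in> U"
  shows "\<exists>k. x \<in> X interior_of \<Union>{M \<in> A k. x \<in> X closure_of M \<and> M \<subseteq> U}"
proof (rule ccontr)
  define F where "F k = \<Union>{M \<in> A k. x \<in> X closure_of M \<and> M \<subseteq> U}" for k
  assume "\<not> ?thesis"
  then have "x \<in> X closure_of (topspace X - F k)" for k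
    using U openin_subset by (fastforce simp: interior_of_closure_of F_def)
  then have "\<forall>k. \<exists>s. range s \<subseteq> topspace X - F k \<and> limitin X s x sequentially"
    using fu unfolding frechet_urysohn_def by blast
  from choice[OF this] obtain xs where
    xs: "\<forall>k. range (xs k) \<subseteq> topspace X - F k \<and> limitin X (xs k) x sequentially" ..
  text \<open>The \<open>j\<close>-th term of the diagonal sequence avoids \<open>F (mk j)\<close> with \<open>mk\<close> injective,
    but eventually it lies in a member of the single level \<open>A m\<close> found below.\<close>
  obtain mk nk where "inj mk" and lim: "limitin X (\<lambda>j. xs (mk j) (nk j)) x sequentially"
    using a4 xs U openin_subset unfolding alpha4_def alpha4_at_def by blast
  obtain \<G> where \<G>: "finite \<G>" "\<G> \<subseteq> \<Union>(range A)" "\<Union>\<G> \<subseteq> U"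
    and ev: "\<forall>\<^sub>F j in sequentially. \<exists>M\<in>\<G>. xs (mk j) (nk j) \<in> M \<and> x \<in> X closure_of M"
    by (rule k_network_convergent_sequence[OF knet lim U])
  obtain m where m: "\<G> \<subseteq> A m"
    using finite_subset_incseq[OF \<G>(1,2) \<open>incseq A\<close>] by blast
  obtain j M where "m \<le> mk j" "M \<in> \<G>" "xs (mk j) (nk j) \<in> M" "x \<in> X closure_of M"
    using eventually_happens'[OF sequentially_bot eventually_conj[OF inj_eventually_ge[OF \<open>inj mk\<close>] ev]]
    by blast
  then have "xs (mk j) (nk j) \<in> F (mk j)"
    using m \<G>(3) incseqD[OF \<open>incseq A\<close>] unfolding F_def by blast
  then show False
    using xs by blast
qed

lemma frechet_urysohn_alpha4_locally_finite_refinable: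
  fixes A :: "nat \<Rightarrow> 'a set set"
  assumes knet: "k_network X (\<Union>(range A))" and "incseq A" and lf: "\<And>k. locally_finite_in X (A k)"
    and fu: "frechet_urysohn X" and a4: "alpha4 X"
  shows "locally_finite_refinable X"
  unfolding locally_finite_refinable_def
proof (intro allI impI)
  fix \<U> assume \<U>: "(\<forall>U\<in>\<U>. openin X U) \<and> topspace X \<subseteq> \<Union>\<U>"
  define PA where "PA k = {M \<in> A k. \<exists>U\<in>\<U>. M \<subseteq> U}" for k
  have incPA: "incseq PA"
    using \<open>incseq A\<close> by (auto simp: incseq_def PA_def)
  have lfPA: "locally_finite_in X (PA k)" for k
    unfolding PA_def by (rule locally_finite_in_subset[OF lf]) blast
  have cover: "\<exists>k. x \<in> X interior_of \<Union>(PA k)" if x: "x \<in> topspace X" for x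
  proof -
    obtain U where U: "U \<in> \<U>" "x \<in> U"
      using \<U> x by blast
    then obtain k where "x \<in> X interior_of \<Union>{M \<in> A k. x \<in> X closure_of M \<and> M \<subseteq> U}"
      using frechet_urysohn_alpha4_level_nbhd[OF knet \<open>incseq A\<close> fu a4] \<U> by blast
    moreover have "\<Union>{M \<in> A k. x \<in> X closure_of M \<and> M \<subseteq> U} \<subseteq> \<Union>(PA k)"
      using U(1) by (auto simp: PA_def)
    ultimately show ?thesis
      using interior_of_mono by blast
  qed
  have "\<Union>(PA k) \<subseteq> topspace X" for k
    using lfPA[of k] by (simp add: locally_finite_in_def)
  moreover have "\<exists>k. x \<in> \<Union>(PA k)" if "x \<in> topspace X" for x
    by (meson cover[OF that] interior_of_subset subsetD)
  ultimately have "\<Union>(layered_refinement X PA) = topspace X"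
    by (rule Union_layered_refinement)
  moreover have "locally_finite_in X (layered_refinement X PA)"
    by (rule locally_finite_layered_refinement[OF incPA lfPA cover])
  moreover have "\<forall>Q\<in>layered_refinement X PA. \<exists>U\<in>\<U>. Q \<subseteq> U"
    by (auto simp: layered_refinement_def PA_def)
  ultimately show "\<exists>\<Q>. locally_finite_in X \<Q> \<and> \<Union>\<Q> = topspace X \<and> (\<forall>Q\<in>\<Q>. \<exists>U\<in>\<U>. Q \<subseteq> U)"
    by blast
qed

lemma frechet_urysohn_alpha4_sigma_locally_finite_base:
  fixes A :: "nat \<Rightarrow> 'a set set"
  assumes reg: "regular_space X" and knet: "k_network X (\<Union>(range A))" and "incseq A"
    and lf: "\<And>k. locally_finite_in X (A k)" and fu: "frechet_urysohn X" and a4: "alpha4 X"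
  obtains \<B> where "\<And>W. W \<in> \<B> \<Longrightarrow> openin X W" "sigma_locally_finite X \<B>"
    "\<And>U x. openin X U \<Longrightarrow> x \<in> U \<Longrightarrow> \<exists>W\<in>\<B>. x \<in> W \<and> W \<subseteq> U"
proof -
  have refinable: "locally_finite_refinable X"
    by (rule frechet_urysohn_alpha4_locally_finite_refinable[OF knet \<open>incseq A\<close> lf fu a4])
  have "\<forall>k. \<exists>S. (\<forall>M. openin X (S M)) \<and> (\<forall>M. X closure_of M \<subseteq> S M) \<and>
          (\<forall>y\<in>topspace X. \<exists>V. openin X V \<and> y \<in> V \<and> finite {M \<in> A k. S M \<inter> V \<noteq> {}})"
    using locally_finite_open_expansion[OF reg refinable lf] by blast
  from choice[OF this] obtain S where
    S: "\<forall>k. (\<forall>M. openin X (S k M)) \<and> (\<forall>M. X closure_of M \<subseteq> S k M) \<and>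
          (\<forall>y\<in>topspace X. \<exists>V. openin X V \<and> y \<in> V \<and> finite {M \<in> A k. S k M \<inter> V \<noteq> {}})" ..
  define B where "B k = {\<Inter>(insert (X interior_of \<Union>\<F>) (S k ` \<F>)) | \<F>. finite \<F> \<and> \<F> \<subseteq> A k}" for k
  show thesis
  proof (rule that[of "\<Union>(range B)"])
    fix W assume "W \<in> \<Union>(range B)"
    then obtain k \<F> where W: "W = \<Inter>(insert (X interior_of \<Union>\<F>) (S k ` \<F>))" "finite \<F>"
      by (auto simp: B_def)
    show "openin X W"
      unfolding W(1) by (intro openin_Inter) (use S W(2) in auto)
  next
    have "locally_finite_in X (B k)" for k
      unfolding B_def by (rule locally_finite_in_finite_Inter_expansion) (use S in blast)
    then show "sigma_locally_finite X (\<Union>(range B))"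
      unfolding sigma_locally_finite_def by blast
  next
    fix U x assume U: "openin X U" "x \<in> U"
    then obtain k where k: "x \<in> X interior_of \<Union>{M \<in> A k. x \<in> X closure_of M \<and> M \<subseteq> U}"
      using frechet_urysohn_alpha4_level_nbhd[OF knet \<open>incseq A\<close> fu a4] by blast
    define \<F> where "\<F> = {M \<in> A k. x \<in> X closure_of M \<and> M \<subseteq> U}"
    have "x \<in> topspace X"
      using U openin_subset by blast
    then have "finite {M \<in> A k. x \<in> X closure_of M}"
      by (rule locally_finite_in_finite_closure_of[OF lf])
    then have "finite \<F>"
      unfolding \<F>_def by (rule finite_subset[rotated]) blast
    then have "\<Inter>(insert (X interior_of \<Union>\<F>) (S k ` \<F>)) \<in> \<Union>(range B)"
      by (auto simp: B_def \<F>_def)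
    moreover have "x \<in> \<Inter>(insert (X interior_of \<Union>\<F>) (S k ` \<F>))"
      using k S by (auto simp: \<F>_def)
    moreover have "\<Inter>(insert (X interior_of \<Union>\<F>) (S k ` \<F>)) \<subseteq> U"
      using interior_of_subset[of X "\<Union>\<F>"] by (auto simp: \<F>_def)
    ultimately show "\<exists>W\<in>\<Union>(range B). x \<in> W \<and> W \<subseteq> U"
      by blast
  qed
qed

theorem theorem2p2:
  fixes X :: "'a topology"
  assumes "aleph_space X"
  shows "metrizable_space X \<longleftrightarrow> frechet_urysohn X \<and> alpha4 X"
proof
  assume "metrizable_space X"
  then show "frechet_urysohn X \<and> alpha4 X"
    by (simp add: metrizable_imp_frechet_urysohn metrizable_imp_alpha4)
next
  assume "frechet_urysohn X \<and> alpha4 X"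
  then have fu: "frechet_urysohn X" and a4: "alpha4 X"
    by simp_all
  obtain \<N> where reg: "regular_space X" and t1: "t1_space X"
    and knet: "k_network X \<N>" and lf: "sigma_locally_finite X \<N>"
    using assms unfolding aleph_space_def by blast
  obtain A where A: "\<N> = \<Union>(range A)" "incseq A" "\<And>k. locally_finite_in X (A k)"
    using sigma_locally_finite_incseq[OF lf] by blast
  obtain \<B> where "\<And>W. W \<in> \<B> \<Longrightarrow> openin X W" "sigma_locally_finite X \<B>"
    "\<And>U x. openin X U \<Longrightarrow> x \<in> U \<Longrightarrow> \<exists>W\<in>\<B>. x \<in> W \<and> W \<subseteq> U"
    using frechet_urysohn_alpha4_sigma_locally_finite_base[OF reg knet[unfolded A(1)] A(2,3) fu a4]
    by blast
  then show "metrizable_space X"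
    by (rule Nagata_Smirnov_metrizable[OF reg t1])
qed

end
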